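(* Let $R$ be a complete valuation ring which is not a field, $F$ its residue field, $Q:R\to F$ the quotient map, and $K$ the field of fractions of $R$ equipped with the induced absolute value $|\cdot|$. Suppose that $K$ is algebraically closed. Denote by $|\cdot|_0$ the trivial norm on $F$. Let $G$ be a cyclic group of order $M$ with generator $u$, and let $b_1,\dots,b_n$ be all the distinct $M$-th roots of unity in $K$. (a) For $k=1,\dots,n$ and $\omega\in[1,\infty)$, set $$\left|\sum_{l=0}^{M-1}a_lu^l\right|_{\alpha_{b_k}^\omega}:=\left|\sum_{l=0}^{M-1}a_lb_k^l\right|^\omega\quad\text{and}\quad \left|\sum_{l=0}^{M-1}a_lu^l\right|_{\beta_{Q(b_k)}}:=\left|\sum_{l=0}^{M-1}Q(a_lb_k^l)\right|_0\qquad(a_0,\dots,a_{M-1}\in R).$$ Then $\mathcal{M}(R[G])=\{\alpha_{b_k}^\omega:\omega\in[1,\infty);\,k=1,\dots,n\}\cup\{\beta_{Q(b_k)}:k=1,\dots,n\}$. (b) As a topological space, $\mathcal{M}(R[G])$ consists of $n$ intervals of the form $[1,\infty]$ corresponding to the elements $b_1,\dots,b_n$, such that the "$1$-ends" of all these intervals are free, while the "$\infty$-ends" of the two intervals corresponding to $b_k$ and $b_l$ are identified with each other if $Q(b_k)=Q(b_l)$. That is, $\mathcal{M}(R[G])$ is homeomorphic to the quotient of $\{1,\dots,n\}\times[1,\infty]$ (with $\{1,\dots,n\}$ discrete) obtained by identifying $(k,\infty)$ with $(l,\infty)$ exactly when $Q(b_k)=Q(b_l)$, where the class of $(k,\omega)$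 with $\omega<\infty$ corresponds to $\alpha_{b_k}^\omega$ and the class of $(k,\infty)$ corresponds to $\beta_{Q(b_k)}$.
   Context: For a commutative unital Banach ring $(S,\|\cdot\|)$, its Berkovich spectrum $\mathcal{M}(S)$ is the set of all non-zero contractive multiplicative seminorms on $S$, with the topology of pointwise convergence. For a finite abelian group $G$, the group ring $S[G]$ is given the norm $\|\sum_{g\in G}a_gg\|:=\max_{g\in G}\|a_g\|$. A valuation ring is an integral domain $R$ with field of fractions $K$ such that for every non-zero $x\in K$, $x\in R$ or $x^{-1}\in R$. It is a complete valuation ring if the totally ordered group $K^\times/R^\times$ is isomorphic to an ordered subgroup of $\mathbb{R}$ and $R$ is complete under the induced norm; equivalently, $R=\{a\in K:|a|\le1\}$ for a complete non-Archimedean valued field $(K,|\cdot|)$. $R$ carries the norm $|\cdot|$. *)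

theory Defs
  imports
    "HOL-Analysis.Analysis"
    "HOL-Computational_Algebra.Polynomial_Factorial"
    "HOL-Library.Poly_Mapping"
begin

subsection \<open>Complete valuation rings\<close>

text \<open>The ring $R$ is a type \<open>'r\<close> of class \<open>idom\<close>, its field of fractions $K$ is
  \<open>'r fract\<close>, and $R$ sits in $K$ as \<open>range to_fract\<close>.\<close>

definition valuation_ring :: "'r::idom itself \<Rightarrow> bool" where
  "valuation_ring (_ :: 'r itself) \<longleftrightarrow>
     (\<forall>x :: 'r fract. x \<noteq> 0 \<longrightarrow> x \<in> range to_fract \<or> inverse x \<in> range to_fract)"

text \<open>The last clause says that \<open>v\<close> has kernel $R^\times$ on $K^\times$ and that it induces an
  isomorphism of the totally ordered group $K^\times/R^\times$ onto a subgroup of the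
  multiplicative group of positive reals (the additive ordered group of reals, via \<open>ln\<close>).
  Such a \<open>v\<close> is unique up to a positive exponent. The ultrametric inequality is
  \<open>induced_absolute_value_ultrametric\<close> below.\<close>

definition induced_absolute_value :: "('r::idom fract \<Rightarrow> real) \<Rightarrow> bool" where
  "induced_absolute_value v \<longleftrightarrow>
     v 0 = 0 \<and> (\<forall>x. x \<noteq> 0 \<longrightarrow> 0 < v x) \<and> (\<forall>x y. v (x * y) = v x * v y) \<and>
     (\<forall>x. v x \<le> 1 \<longleftrightarrow> x \<in> range to_fract)"

definition complete_valuation_ring :: "('r::idom fract \<Rightarrow> real) \<Rightarrow> bool" where
  "complete_valuation_ring v \<longleftrightarrow>
     valuation_ring TYPE('r) \<and> induced_absolute_value v \<and>
     Metric_space.mcomplete (UNIV :: 'r set) (\<lambda>x y. v (to_fract (x - y)))"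

lemma induced_absolute_value_ultrametric:
  assumes "induced_absolute_value v"
  shows "v (x + y) \<le> max (v x) (v y)"
proof -
  have v0: "v 0 = 0" and pos: "\<And>x. x \<noteq> 0 \<Longrightarrow> 0 < v x"
    and mult: "\<And>x y. v (x * y) = v x * v y"
    and ball: "\<And>x. v x \<le> 1 \<longleftrightarrow> x \<in> range to_fract"
    using assms unfolding induced_absolute_value_def by blast+
  have aux: "v (x + y) \<le> v y" if le: "v x \<le> v y" for x y
  proof (cases "y = 0")
    case True
    with le v0 pos[of x] have "x = 0" by fastforce
    with True show ?thesis by simp
  next
    case False
    have eq: "v z = v (z / y) * v y" for z
      using mult[of "z / y" y] False by simp
    have "v (x / y) * v y \<le> 1 * v y" using le eq[of x] by simp
    then have "v (x / y) \<le> 1" using pos[OF False] by simp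
    then obtain r where "x / y = to_fract r" using ball by blast
    then have "(x + y) / y = to_fract (r + 1)" using False by (simp add: add_divide_distrib)
    then have "v ((x + y) / y) \<le> 1" using ball by blast
    then show ?thesis using eq[of "x + y"] pos[OF False] by simp
  qed
  show ?thesis using aux[of x y] aux[of y x] by (auto simp: add.commute max_def)
qed

lemma induced_absolute_value_metric:
  assumes iav: "induced_absolute_value (v :: 'r::idom fract \<Rightarrow> real)"
  shows "Metric_space (UNIV :: 'r set) (\<lambda>x y. v (to_fract (x - y)))"
proof -
  have v0: "v 0 = 0" and pos: "\<And>x. x \<noteq> 0 \<Longrightarrow> 0 < v x"
    and mult: "\<And>x y. v (x * y) = v x * v y"
    using iav unfolding induced_absolute_value_def by blast+
  have nonneg: "0 \<le> v x" for x using v0 pos[of x] by (cases "x = 0") auto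
  have "v 1 = 1" using mult[of 1 1] pos[of 1] by simp
  then have "v (-1) * v (-1) = 1" using mult[of "-1" "-1"] by simp
  then have "v (-1) = 1" using nonneg[of "-1"] by (simp add: square_eq_1_iff)
  then have neg: "v (- x) = v x" for x using mult[of "-1" x] by simp
  show ?thesis
  proof
    fix x y z :: 'r
    show "0 \<le> v (to_fract (x - y))" by (rule nonneg)
    show "v (to_fract (x - y)) = v (to_fract (y - x))"
      using neg[of "to_fract (x - y)"] by simp
    show "v (to_fract (x - y)) = 0 \<longleftrightarrow> x = y"
      using v0 pos[of "to_fract (x - y)"] by (cases "x = y") auto
    show "v (to_fract (x - z)) \<le> v (to_fract (x - y)) + v (to_fract (y - z))"
      using induced_absolute_value_ultrametric[OF iav, of "to_fract (x - y)" "to_fract (y - z)"]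
        nonneg[of "to_fract (x - y)"] nonneg[of "to_fract (y - z)"]
      by (simp flip: to_fract_add)
  qed
qed

definition algebraically_closed :: "'k::field itself \<Rightarrow> bool" where
  "algebraically_closed (_ :: 'k itself) \<longleftrightarrow>
     (\<forall>p :: 'k poly. 0 < degree p \<longrightarrow> (\<exists>x. poly p x = 0))"

text \<open>A field together with the quotient map of \<open>'r\<close> modulo the ideal of non-units, which is the
  maximal ideal when \<open>'r\<close> is a valuation ring. This determines \<open>'f\<close> and \<open>Q\<close> up to
  unique isomorphism.\<close>

definition residue_field_map :: "('r::idom \<Rightarrow> 'f::field) \<Rightarrow> bool" where
  "residue_field_map Q \<longleftrightarrow>
     Q 1 = 1 \<and> (\<forall>x y. Q (x + y) = Q x + Q y) \<and> (\<forall>x y. Q (x * y) = Q x * Q y) \<and>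
     surj Q \<and> (\<forall>x. Q x = 0 \<longleftrightarrow> \<not> x dvd 1)"

definition trivial_norm :: "'f::field \<Rightarrow> real" where
  "trivial_norm x = (if x = 0 then 0 else 1)"


subsection \<open>Berkovich spectra\<close>

definition multiplicative_seminorm :: "('s::comm_ring_1 \<Rightarrow> real) \<Rightarrow> bool" where
  "multiplicative_seminorm p \<longleftrightarrow>
     (\<forall>x. 0 \<le> p x) \<and> p 0 = 0 \<and> (\<forall>x. p (- x) = p x) \<and>
     (\<forall>x y. p (x + y) \<le> p x + p y) \<and> (\<forall>x y. p (x * y) = p x * p y)"

definition berkovich_spectrum :: "('s::comm_ring_1 \<Rightarrow> real) \<Rightarrow> ('s \<Rightarrow> real) set" where
  "berkovich_spectrum N =
     {p. multiplicative_seminorm p \<and> (\<exists>x. p x \<noteq> 0) \<and> (\<forall>x. p x \<le> N x)}"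

definition berkovich_topology :: "('s::comm_ring_1 \<Rightarrow> real) \<Rightarrow> ('s \<Rightarrow> real) topology" where
  "berkovich_topology N = subtopology (powertop_real UNIV) (berkovich_spectrum N)"


subsection \<open>Group rings of finite cyclic groups\<close>

text \<open>Finite abelian groups are written additively, so that $S[G]$ is the convolution ring
  \<open>'g \<Rightarrow>\<^sub>0 's\<close>, in which the group element \<open>g\<close> is \<open>Poly_Mapping.single g 1\<close>. The element
  $u^l$ is \<open>group_power u l\<close>.\<close>

definition group_power :: "'g::ab_group_add \<Rightarrow> nat \<Rightarrow> 'g" where
  "group_power u l = (\<Sum>i<l. u)"

definition cyclic_generator :: "'g::ab_group_add \<Rightarrow> bool" where
  "cyclic_generator u \<longleftrightarrow> (\<forall>g. \<exists>l. g = group_power u l \<or> g = - group_power u l)"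

definition group_ring_norm ::
    "('r::idom fract \<Rightarrow> real) \<Rightarrow> ('g::{ab_group_add,finite} \<Rightarrow>\<^sub>0 'r) \<Rightarrow> real" where
  "group_ring_norm v x = Max (range (\<lambda>g. v (to_fract (Poly_Mapping.lookup x g))))"

text \<open>In both seminorms the coefficient $a_l$ of \<open>x\<close> is \<open>lookup x (group_power u l)\<close>, with
  \<open>M = CARD('g)\<close>.\<close>

definition alpha_seminorm ::
    "('r::idom fract \<Rightarrow> real) \<Rightarrow> 'g::{ab_group_add,finite} \<Rightarrow> 'r fract \<Rightarrow> real \<Rightarrow> ('g \<Rightarrow>\<^sub>0 'r) \<Rightarrow> real"
  where
  "alpha_seminorm v u b \<omega> x =
     v (\<Sum>l<CARD('g). to_fract (Poly_Mapping.lookup x (group_power u l)) * b ^ l) powr \<omega>"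

text \<open>For $z \in R \subseteq K$, \<open>inv to_fract z\<close> is \<open>z\<close> as an element of the type \<open>'r\<close>. It is
  only meaningful for \<open>z\<close> in \<open>range to_fract\<close>; in particular for the products $a_l b^l$
  with \<open>b\<close> a root of unity.\<close>

definition residue :: "('r::idom \<Rightarrow> 'f::field) \<Rightarrow> 'r fract \<Rightarrow> 'f" where
  "residue Q z = Q (inv to_fract z)"

definition beta_seminorm ::
    "('r::idom \<Rightarrow> 'f::field) \<Rightarrow> 'g::{ab_group_add,finite} \<Rightarrow> 'r fract \<Rightarrow> ('g \<Rightarrow>\<^sub>0 'r) \<Rightarrow> real" where
  "beta_seminorm Q u b x =
     trivial_norm
       (\<Sum>l<CARD('g). residue Q (to_fract (Poly_Mapping.lookup x (group_power u l)) * b ^ l))"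


subsection \<open>Gluing intervals\<close>

definition quotient_topology :: "'a topology \<Rightarrow> ('a \<times> 'a) set \<Rightarrow> 'a set topology" where
  "quotient_topology X r =
     topology (\<lambda>U. U \<subseteq> topspace X // r \<and> openin X {x \<in> topspace X. r `` {x} \<in> U})"

lemma openin_quotient_topology:
  "openin (quotient_topology X r) U \<longleftrightarrow>
     U \<subseteq> topspace X // r \<and> openin X {x \<in> topspace X. r `` {x} \<in> U}"
proof -
  let ?P = "\<lambda>U. U \<subseteq> topspace X // r \<and> openin X {x \<in> topspace X. r `` {x} \<in> U}"
  have "istopology ?P"
    unfolding istopology_def
  proof (intro conjI allI impI)
    fix S T assume S: "?P S" and T: "?P T"
    have "{x \<in> topspace X. r `` {x} \<in> S \<inter> T} =
        {x \<in> topspace X. r `` {x} \<in> S} \<inter> {x \<in> topspace X. r `` {x} \<in> T}" by blast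
    with S T show "openin X {x \<in> topspace X. r `` {x} \<in> S \<inter> T}" by auto
    show "S \<inter> T \<subseteq> topspace X // r" using S by blast
  next
    fix \<K> assume K: "\<forall>K\<in>\<K>. ?P K"
    have "{x \<in> topspace X. r `` {x} \<in> \<Union>\<K>} = (\<Union>K\<in>\<K>. {x \<in> topspace X. r `` {x} \<in> K})"
      by blast
    with K show "openin X {x \<in> topspace X. r `` {x} \<in> \<Union>\<K>}" by auto
    show "\<Union>\<K> \<subseteq> topspace X // r" using K by blast
  qed
  then show ?thesis unfolding quotient_topology_def by simp
qed

definition intervals_topology :: "nat \<Rightarrow> (nat \<times> ereal) topology" where
  "intervals_topology n =
     prod_topology (discrete_topology {1..n}) (subtopology euclidean {1..\<infinity>})"

definition gluing ::
    "('r::idom \<Rightarrow> 'f::field) \<Rightarrow> nat \<Rightarrow> (nat \<Rightarrow> 'r fract) \<Rightarrow> ((nat \<times> ereal) \<times> (nat \<times> ereal)) set"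
  where
  "gluing Q n b =
     {((k, s), (l, t)). k \<in> {1..n} \<and> l \<in> {1..n} \<and> s \<in> {1..\<infinity>} \<and> t \<in> {1..\<infinity>} \<and>
        (k = l \<and> s = t \<or> s = \<infinity> \<and> t = \<infinity> \<and> residue Q (b k) = residue Q (b l))}"

lemma equiv_gluing: "equiv (topspace (intervals_topology n)) (gluing Q n b)"
  by (rule equivI)
    (auto simp: intervals_topology_def gluing_def refl_on_def sym_def trans_def)

end

theory Submission
  imports Defs
begin

text \<open>
  A bounded multiplicative seminorm \<open>p\<close> on $R[G]$ is constrained from two sides.

  On the group side, $u^M = 1$, and over the algebraically closed field $K$ the polynomial
  $X^M - 1$ is a product of linear factors $X - \beta$. Each $\beta$ is a root of unity, so it
  has absolute value at most one and lies in $R$; hence the factorisation already holds in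
  $R[X]$. Evaluating it at $X = u$ gives $\prod (u - \beta) = 0$ in $R[G]$, and multiplicativity
  forces $p(u - \beta) = 0$ for one of the roots. Every \<open>x\<close> is congruent to the constant
  $x(\beta)$ modulo $u - \beta$, so $p$ is the pullback of its restriction to $R$ along the
  evaluation $R[G] \to R$, $u \mapsto \beta$ (\<open>seminorm_vanishes_on_kernel\<close>,
  \<open>berkovich_spectrum_pullback\<close>).

  On the coefficient side, a bounded multiplicative seminorm on $R$ is one on units and respects
  divisibility, so its value at \<open>r\<close> is a monotone multiplicative function of $|r|$. Since the
  value group has rank one, that function is $t \mapsto t^\omega$ with $1 \le \omega < \infty$, or
  its limit for $\omega \to \infty$, which sends $1$ to $1$ and everything smaller to $0$
  (\<open>spectrum_imp_ext_powr\<close>). The limit is the trivial norm of the residue.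

  Together this parametrises the spectrum by $\{1,\dots,n\} \times [1,\infty]$. The
  parametrisation is continuous, even at $\infty$, from a compact space onto a Hausdorff space, so
  it is a quotient map, and the spectrum is the quotient by its fibres. Testing on a non-zero
  non-unit recovers $\omega$, and testing on $u - b_k$ tells the roots apart: this element
  evaluates at $b_l$ to $b_l - b_k$, which is killed for finite $\omega$ only if $b_k = b_l$ and
  for $\omega = \infty$ exactly if $b_k$ and $b_l$ have the same residue. These fibres are the
  prescribed gluing (\<open>spectrum_param_eq_iff\<close>).
\<close>

section \<open>Powers with exponents up to infinity\<close>

text \<open>
  The value at infinity is the pointwise limit on $[0,1]$, the range of the absolute value on $R$.
\<close>

definition ext_powr :: "real \<Rightarrow> ereal \<Rightarrow> real" where
  "ext_powr t s = (if s = \<infinity> then if t = 1 then 1 else 0 else t powr real_of_ereal s)"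

lemma ext_powr_ereal [simp]: "ext_powr t (ereal s) = t powr s"
  and ext_powr_infinity [simp]: "ext_powr t \<infinity> = (if t = 1 then 1 else 0)"
  by (auto simp: ext_powr_def)

lemma ext_powr_0 [simp]: "ext_powr 0 s = 0"
  and ext_powr_1 [simp]: "ext_powr 1 s = 1"
  and ext_powr_nonneg [simp]: "0 \<le> ext_powr t s"
  by (auto simp: ext_powr_def)

lemma ext_powr_mult:
  assumes "t \<in> {0..1}" "t' \<in> {0..1}"
  shows "ext_powr (t * t') s = ext_powr t s * ext_powr t' s"
proof -
  have "t = 1 \<and> t' = 1" if "t * t' = 1"
    using that assms mult_left_le[of t' t] mult_left_le[of t t'] by (auto simp: mult.commute)
  then show ?thesis using assms by (auto simp: ext_powr_def powr_mult)
qed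

lemma ext_powr_mono:
  assumes "0 \<le> t" "t \<le> t'" "t' \<le> 1" "1 \<le> s"
  shows "ext_powr t s \<le> ext_powr t' s"
  using assms by (cases s) (auto intro: powr_mono2)

lemma ext_powr_le:
  assumes "t \<in> {0..1}" "1 \<le> s"
  shows "ext_powr t s \<le> t"
proof (cases s)
  case (real r)
  then show ?thesis using assms powr_mono'[of 1 r t] by auto
qed (use assms in auto)

lemma ext_powr_eq_0_iff:
  assumes "t \<in> {0..1}"
  shows "ext_powr t s = 0 \<longleftrightarrow> t = 0 \<or> s = \<infinity> \<and> t < 1"
  using assms by (auto simp: ext_powr_def)

lemma ext_powr_inj:
  assumes "0 < t" "t < 1" "1 \<le> s" "1 \<le> s'" and eq: "ext_powr t s = ext_powr t s'"
  shows "s = s'"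
proof (cases s; cases s')
  fix r r' assume "s = ereal r" "s' = ereal r'"
  then show ?thesis using assms by (auto simp: powr_inj)
qed (use assms in auto)

text \<open>
  This is what attaches the point at infinity to each half-open interval in the spectrum.
\<close>

lemma continuous_on_ext_powr:
  assumes "t \<in> {0..1}"
  shows "continuous_on {1..\<infinity>} (ext_powr t)"
proof -
  consider "t = 0" | "t = 1" | "0 < t" "t < 1" using assms by fastforce
  then show ?thesis
  proof cases
    case 3
    have "isCont (ext_powr t) s" if "1 \<le> s" for s
    proof (cases s)
      case (real r)
      have "((\<lambda>r. t powr r) \<longlongrightarrow> t powr r) (at r)"
        using 3 by (intro tendsto_intros) auto
      then show ?thesis using real
        unfolding isCont_def by (simp add: at_ereal filterlim_filtermap)
    next
      case PInf
      have "((\<lambda>r. t powr r) \<longlongrightarrow> 0) at_top"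
        using 3 by real_asymp
      then show ?thesis using PInf 3
        unfolding isCont_def by (simp add: at_infty_ereal_eq_at_top filterlim_filtermap)
    qed (use that in auto)
    then show ?thesis by (intro continuous_at_imp_continuous_on) auto
  qed (simp_all add: continuous_on_const)
qed

section \<open>Bounded multiplicative seminorms on a valuation ring\<close>

text \<open>
  The Archimedean core of the classification: comparing integer powers of two elements determines
  the quotient of their logarithms, because the rationals are dense. It will be applied to the
  negated logarithms of an absolute value ($a$, $b$) and of a seminorm ($a'$, $b'$).
\<close>

lemma power_comparisons_imp_proportional:
  fixes a b a' b' :: real
  assumes "0 \<le> a" "0 < b" "0 < b'"
    and lower: "\<And>m n. real n * b \<le> real m * a \<Longrightarrow> real n * b' \<le> real m * a'"
    and upper: "\<And>m n. real m * a \<le> real n * b \<Longrightarrow> real m * a' \<le> real n * b'"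
  shows "a' * b = a * b'"
proof (rule ccontr)
  define d where "d = \<bar>a' * b - a * b'\<bar>"
  assume "a' * b \<noteq> a * b'"
  then have "0 < d" by (simp add: d_def)
  then obtain m :: nat where m: "b * b' < m * d" using reals_Archimedean3 by blast
  \<comment> \<open>$m a$ and $m a'$ are trapped between the same multiples of $b$ and $b'$, which bounds
    $m d$ independently of $m$.\<close>
  define n where "n = nat \<lfloor>m * a / b\<rfloor>"
  have "0 \<le> m * a / b" using assms by simp
  then have "real n \<le> m * a / b" "m * a / b \<le> real (Suc n)"
    unfolding n_def by linarith+
  then have l: "n * b \<le> m * a" and u: "m * a \<le> Suc n * b"
    using \<open>0 < b\<close> by (simp_all only: pos_le_divide_eq pos_divide_le_eq)
  have "m * a' * b \<le> Suc n * b' * b" "n * b' * b \<le> m * a' * b"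
    using lower[OF l] upper[OF u] \<open>0 < b\<close> by (intro mult_right_mono; simp)+
  moreover have "m * a * b' \<le> Suc n * b * b'" "n * b * b' \<le> m * a * b'"
    using l u \<open>0 < b'\<close> by (intro mult_right_mono; simp)+
  ultimately have "\<bar>m * a' * b - m * a * b'\<bar> \<le> b * b'"
    by (simp add: algebra_simps abs_le_iff)
  moreover have "\<bar>m * a' * b - m * a * b'\<bar> = m * d"
    by (simp add: d_def abs_mult flip: right_diff_distrib mult.assoc)
      (simp add: mult.assoc abs_mult flip: right_diff_distrib)
  ultimately show False using m by simp
qed

lemma multiplicative_seminormD:
  assumes "multiplicative_seminorm p"
  shows "0 \<le> p x" "p 0 = 0" "p (- x) = p x" "p (x + y) \<le> p x + p y" "p (x * y) = p x * p y"
  using assms unfolding multiplicative_seminorm_def by blast+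

lemma multiplicative_seminorm_one:
  assumes "multiplicative_seminorm p" "p x \<noteq> 0"
  shows "p 1 = 1"
  using multiplicative_seminormD(5)[OF assms(1), of x 1] assms(2) by simp

lemma multiplicative_seminorm_power:
  assumes "multiplicative_seminorm p" "p 1 = 1"
  shows "p (x ^ n) = p x ^ n"
  using assms by (induction n) (auto simp: multiplicative_seminormD(5))

lemma multiplicative_seminorm_dvd_zero:
  assumes "multiplicative_seminorm p" "y dvd x" "p y = 0"
  shows "p x = 0"
  using assms by (auto simp: dvd_def multiplicative_seminormD(5))

lemma multiplicative_seminorm_cong_zero:
  assumes p: "multiplicative_seminorm p" and "p (x - y) = 0"
  shows "p x = p y"
  using multiplicative_seminormD(4)[OF p, of "x - y" y]
    multiplicative_seminormD(4)[OF p, of "- (x - y)" x] multiplicative_seminormD(3)[OF p, of "x - y"]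
    assms(2) by simp

lemma multiplicative_seminorm_comp:
  assumes p: "multiplicative_seminorm p"
    and "\<And>x y. h (x + y) = h x + h y" "\<And>x y. h (x * y) = h x * h y"
  shows "multiplicative_seminorm (\<lambda>x. p (h x))"
proof -
  have "h 0 = 0" using assms(2)[of 0 0] by simp
  moreover have "h (- x) = - h x" for x
    using assms(2)[of x "- x"] \<open>h 0 = 0\<close> by (simp add: eq_neg_iff_add_eq_0 add.commute)
  ultimately show ?thesis
    using p unfolding multiplicative_seminorm_def by (simp add: assms(2,3))
qed

text \<open>
  The absolute value restricted to $R$, without reference to the field of fractions: the last
  axiom says that it is bounded by one and that $R$ is a valuation ring. The ultrametric
  inequality follows, since a common divisor divides the sum. Rank at most one is built into the values
  being real.
\<close>

locale rank_one_valuation =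
  fixes w :: "'r::idom \<Rightarrow> real"
  assumes nonneg [simp]: "0 \<le> w x"
    and eq_0_iff [simp]: "w x = 0 \<longleftrightarrow> x = 0"
    and mult: "w (x * y) = w x * w y"
    and le_iff_dvd: "w x \<le> w y \<longleftrightarrow> y dvd x"
begin

lemma zero [simp]: "w 0 = 0"
  by simp

lemma one [simp]: "w 1 = 1"
  using mult[of 1 1] by (auto simp del: eq_0_iff simp: eq_0_iff[of 1])

lemma le_1 [simp]: "w x \<le> 1"
  using le_iff_dvd[of x 1] by simp

lemma eq_1_iff: "w x = 1 \<longleftrightarrow> x dvd 1"
  using le_iff_dvd[of 1 x] le_1[of x] by force

lemma power: "w (x ^ n) = w x ^ n"
  by (induction n) (auto simp: mult)

lemma minus [simp]: "w (- x) = w x"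
  by (intro antisym) (simp_all add: le_iff_dvd)

lemma ultrametric: "w (x + y) \<le> max (w x) (w y)"
proof (cases "w x \<le> w y")
  case True
  then have "w (x + y) \<le> w y" by (simp add: le_iff_dvd)
  then show ?thesis by simp
next
  case False
  then have "x dvd y" using le_iff_dvd[of y x] by linarith
  then have "w (x + y) \<le> w x" by (simp add: le_iff_dvd)
  then show ?thesis by simp
qed

lemma sum_le:
  assumes "\<And>i. i \<in> A \<Longrightarrow> w (f i) \<le> C" "0 \<le> C"
  shows "w (sum f A) \<le> C"
  using assms
proof (induction A rule: infinite_finite_induct)
  case (insert i A)
  then show ?case using ultrametric[of "f i" "sum f A"] by force
qed auto

lemma ext_powr_in_spectrum:
  assumes "1 \<le> s"
  shows "(\<lambda>x. ext_powr (w x) s) \<in> berkovich_spectrum w"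
proof -
  have "ext_powr (w (x + y)) s \<le> ext_powr (w x) s + ext_powr (w y) s" for x y
  proof -
    have "ext_powr (w (x + y)) s \<le> ext_powr (max (w x) (w y)) s"
      using assms ultrametric by (intro ext_powr_mono) auto
    also have "\<dots> \<le> ext_powr (w x) s + ext_powr (w y) s"
      by (auto simp: max_def)
    finally show ?thesis .
  qed
  moreover have "ext_powr (w 1) s \<noteq> 0" by simp
  ultimately show ?thesis
    using assms unfolding berkovich_spectrum_def multiplicative_seminorm_def
    by (auto simp: ext_powr_mult mult ext_powr_le intro!: exI[of _ 1])
qed

text \<open>
  A seminorm below $w$ respects divisibility, hence the order given by $w$. If it kills $\pi$, it
  kills all non-units, because each has a power divisible by $\pi$. Otherwise its kernel is zero, and
  the comparison of powers with those of $\pi$ forces $\ln p$ to be proportional to $\ln w$.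
\<close>

lemma spectrum_imp_ext_powr:
  assumes \<pi>: "0 < w \<pi>" "w \<pi> < 1" and p: "p \<in> berkovich_spectrum w"
  obtains s where "1 \<le> s" "p = (\<lambda>x. ext_powr (w x) s)"
proof -
  have sn: "multiplicative_seminorm p" and le: "\<And>x. p x \<le> w x"
    using p by (auto simp: berkovich_spectrum_def)
  have p1: "p 1 = 1"
    using p multiplicative_seminorm_one[of p] by (auto simp: berkovich_spectrum_def)
  note [simp] = multiplicative_seminormD(1,2)[OF sn]
  note p_mult = multiplicative_seminormD(5)[OF sn]
  note p_power = multiplicative_seminorm_power[OF sn p1]
  have mono: "p x \<le> p y" if "w x \<le> w y" for x y
  proof -
    from that obtain z where "x = y * z" using le_iff_dvd by auto
    moreover have "p z \<le> 1" using le[of z] le_1[of z] by linarith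
    ultimately show ?thesis by (simp add: p_mult mult_left_le)
  qed
  have "\<pi> \<noteq> 0" using \<pi>(1) by auto
  have small_power: "\<exists>n. w (y ^ n) \<le> w x" if "w y < 1" "x \<noteq> 0" for x y
  proof -
    have "0 < w x" using that(2) nonneg[of x] eq_0_iff[of x] by linarith
    then show ?thesis
      using real_arch_pow_inv[OF _ that(1)] by (auto simp: power intro: less_imp_le)
  qed
  show ?thesis
  proof (cases "p \<pi> = 0")
    case True
    have "p x = ext_powr (w x) \<infinity>" for x
    proof (cases "w x = 1")
      case False
      then have "w x < 1" using le_1[of x] by linarith
      then obtain n where "w (x ^ n) \<le> w \<pi>" using small_power[OF _ \<open>\<pi> \<noteq> 0\<close>] by blast
      then have "p x ^ n \<le> 0" using mono[of "x ^ n" \<pi>] True by (simp add: p_power)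
      then have "p x = 0"
        using zero_less_power[of "p x" n] multiplicative_seminormD(1)[OF sn, of x] by linarith
      then show ?thesis using False by simp
    qed (use mono[of 1 x] le[of x] p1 in auto)
    then show ?thesis using that[of \<infinity>] by auto
  next
    case False
    then have p\<pi>: "0 < p \<pi>" "p \<pi> < 1"
      using multiplicative_seminormD(1)[OF sn, of \<pi>] le[of \<pi>] \<pi> by linarith+
    have pos: "0 < p x" if "x \<noteq> 0" for x
    proof -
      obtain n where "w (\<pi> ^ n) \<le> w x" using small_power[OF \<pi>(2) \<open>x \<noteq> 0\<close>] by blast
      then have "p \<pi> ^ n \<le> p x" using mono p_power by metis
      moreover have "0 < p \<pi> ^ n" using p\<pi>(1) by simp
      ultimately show ?thesis by linarith
    qed
    define \<omega> where "\<omega> = ln (p \<pi>) / ln (w \<pi>)"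
    have "ln (p \<pi>) \<le> ln (w \<pi>)" using le[of \<pi>] p\<pi> by simp
    then have \<omega>: "1 \<le> \<omega>" using \<pi> by (simp add: \<omega>_def le_divide_eq_1)
    have "p x = w x powr \<omega>" for x
    proof (cases "x = 0")
      case nz: False
      then have wx: "0 < w x" using nonneg[of x] eq_0_iff[of x] by linarith
      have log_le: "real m * - ln (t y) \<le> real n * - ln (t z) \<longleftrightarrow> t z ^ n \<le> t y ^ m"
        if "0 < t y" "0 < t z" for t :: "'r \<Rightarrow> real" and m n y z
        using that by (simp flip: ln_realpow)
      have "- ln (p x) * - ln (w \<pi>) = - ln (w x) * - ln (p \<pi>)"
      proof (rule power_comparisons_imp_proportional)
        show "0 \<le> - ln (w x)" using wx by simp
        show "0 < - ln (w \<pi>)" using \<pi> by simp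
        show "0 < - ln (p \<pi>)" using p\<pi> by simp
        show "real n * - ln (p \<pi>) \<le> real m * - ln (p x)"
          if "real n * - ln (w \<pi>) \<le> real m * - ln (w x)" for m n
          using that mono[of "x ^ m" "\<pi> ^ n"] wx \<pi> p\<pi> pos[OF nz]
          by (simp only: log_le power p_power)
        show "real m * - ln (p x) \<le> real n * - ln (p \<pi>)"
          if "real m * - ln (w x) \<le> real n * - ln (w \<pi>)" for m n
          using that mono[of "\<pi> ^ n" "x ^ m"] wx \<pi> p\<pi> pos[OF nz]
          by (simp only: log_le power p_power)
      qed
      then have "ln (p x) = \<omega> * ln (w x)" using \<pi> by (simp add: \<omega>_def field_simps)
      moreover have "p x = exp (ln (p x))" using pos[OF nz] by simp
      ultimately show ?thesis using nz by (simp add: powr_def)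
    qed simp
    then show ?thesis using that[of "ereal \<omega>"] \<omega> by auto
  qed
qed

end

lemma rank_one_valuation_of_absolute_value:
  assumes "induced_absolute_value v"
  shows "rank_one_valuation (\<lambda>x. v (to_fract x))"
proof -
  have v0: "v 0 = 0" and pos: "\<And>x. x \<noteq> 0 \<Longrightarrow> 0 < v x"
    and mult: "\<And>x y. v (x * y) = v x * v y"
    and ball: "\<And>x. v x \<le> 1 \<longleftrightarrow> x \<in> range to_fract"
    using assms unfolding induced_absolute_value_def by blast+
  have nonneg: "0 \<le> v x" for x using v0 pos[of x] by (cases "x = 0") auto
  show ?thesis
  proof
    fix x y :: 'a
    show "v (to_fract x) = 0 \<longleftrightarrow> x = 0" using v0 pos[of "to_fract x"] by fastforce
    show "v (to_fract x) \<le> v (to_fract y) \<longleftrightarrow> y dvd x"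
    proof (cases "y = 0")
      case True
      then show ?thesis using v0 pos[of "to_fract x"] by fastforce
    next
      case False
      define q where "q = to_fract x / to_fract y"
      have q: "to_fract x = q * to_fract y" using False by (simp add: q_def)
      have "v (to_fract x) \<le> v (to_fract y) \<longleftrightarrow> q \<in> range to_fract"
        using pos[of "to_fract y"] False by (simp add: q mult flip: ball)
      also have "\<dots> \<longleftrightarrow> (\<exists>z. to_fract x = to_fract (z * y))"
        using False by (auto simp: q)
      also have "\<dots> \<longleftrightarrow> y dvd x" by (auto simp: dvd_def mult.commute simp del: to_fract_mult)
      finally show ?thesis .
    qed
  qed (simp_all add: nonneg mult)
qed

text \<open>
  The ring $S$ is an algebra over $R$ by $c$, with contractive evaluations
  $E_i$ to $R$ that retract it. If every point of the spectrum of $S$ factors through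
  some $E_i$, which the assumption \<open>kernel\<close> expresses without quotient rings, the spectrum of $S$
  is the union of copies of that of $R$.
\<close>

lemma berkovich_spectrum_pullback:
  fixes N :: "'s::comm_ring_1 \<Rightarrow> real" and w :: "'r::comm_ring_1 \<Rightarrow> real"
    and c :: "'r \<Rightarrow> 's" and E :: "'i \<Rightarrow> 's \<Rightarrow> 'r"
  assumes c_add: "\<And>x y. c (x + y) = c x + c y" and c_mult: "\<And>x y. c (x * y) = c x * c y"
    and E_add: "\<And>i x y. i \<in> I \<Longrightarrow> E i (x + y) = E i x + E i y"
    and E_mult: "\<And>i x y. i \<in> I \<Longrightarrow> E i (x * y) = E i x * E i y"
    and E_c: "\<And>i r. i \<in> I \<Longrightarrow> E i (c r) = r"
    and N_c: "\<And>r. N (c r) \<le> w r"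
    and w_E: "\<And>i x. i \<in> I \<Longrightarrow> w (E i x) \<le> N x"
    and kernel: "\<And>p. p \<in> berkovich_spectrum N \<Longrightarrow> \<exists>i\<in>I. \<forall>x. p (x - c (E i x)) = 0"
  shows "berkovich_spectrum N = {\<lambda>x. q (E i x) | i q. i \<in> I \<and> q \<in> berkovich_spectrum w}"
proof (intro equalityI subsetI)
  fix p assume p: "p \<in> berkovich_spectrum N"
  then obtain i where i: "i \<in> I" "\<And>x. p (x - c (E i x)) = 0" using kernel by blast
  have sn: "multiplicative_seminorm p" and le: "\<And>x. p x \<le> N x" and nz: "\<exists>x. p x \<noteq> 0"
    using p by (auto simp: berkovich_spectrum_def)
  have eq: "p x = p (c (E i x))" for x
    using multiplicative_seminorm_cong_zero[OF sn i(2)] .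
  have "\<exists>r. p (c r) \<noteq> 0" using nz eq by metis
  then have "(\<lambda>r. p (c r)) \<in> berkovich_spectrum w"
    using multiplicative_seminorm_comp[OF sn, of c, OF c_add c_mult] order_trans[OF le N_c]
    unfolding berkovich_spectrum_def by auto
  then show "p \<in> {\<lambda>x. q (E i x) | i q. i \<in> I \<and> q \<in> berkovich_spectrum w}"
    using i(1) eq by (auto intro!: exI[of _ i] exI[of _ "\<lambda>r. p (c r)"])
next
  fix p assume "p \<in> {\<lambda>x. q (E i x) | i q. i \<in> I \<and> q \<in> berkovich_spectrum w}"
  then obtain i q where p: "p = (\<lambda>x. q (E i x))" and i: "i \<in> I" and q: "q \<in> berkovich_spectrum w"
    by blast
  have sn: "multiplicative_seminorm q" and le: "\<And>x. q x \<le> w x" and nz: "\<exists>x. q x \<noteq> 0"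
    using q by (auto simp: berkovich_spectrum_def)
  have "multiplicative_seminorm p"
    unfolding p using i by (intro multiplicative_seminorm_comp[OF sn] E_add E_mult)
  moreover have "\<exists>x. p x \<noteq> 0" using nz E_c[OF i] unfolding p by metis
  ultimately show "p \<in> berkovich_spectrum N"
    unfolding berkovich_spectrum_def p using order_trans[OF le w_E[OF i]] by auto
qed


section \<open>Factoring $X^m - 1$ over a valuation ring\<close>

lemma monic_splits:
  fixes f :: "'k::field poly"
  assumes ac: "algebraically_closed TYPE('k)" and "lead_coeff f = 1"
  shows "\<exists>as. f = (\<Prod>a\<leftarrow>as. [:- a, 1:])"
  using assms(2)
proof (induction "degree f" arbitrary: f)
  case 0
  then have "f = 1" by (auto elim!: degree_eq_zeroE)
  then show ?case by (intro exI[of _ "[]"]) simp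
next
  case (Suc d)
  then obtain a where "poly f a = 0" using ac unfolding algebraically_closed_def by force
  then obtain g where f: "f = [:- a, 1:] * g" by (auto simp: poly_eq_0_iff_dvd dvd_def)
  then have "g \<noteq> 0" using Suc.prems by auto
  then have "degree f = Suc (degree g)" by (simp add: f degree_mult_eq del: mult_pCons_left)
  moreover have "lead_coeff g = 1"
    using Suc.prems by (simp add: f lead_coeff_mult del: mult_pCons_left)
  ultimately obtain as where "g = (\<Prod>a\<leftarrow>as. [:- a, 1:])" using Suc.hyps by auto
  then show ?case using f by (intro exI[of _ "a # as"]) simp
qed

text \<open>
  Used twice: for the embedding of $R$ into its field of fractions, to descend a factorisation, and
  for the embedding of $R$ into the group ring, to push it forward.
\<close>

lemma map_poly_prod_linear:
  fixes h :: "'a::comm_ring_1 \<Rightarrow> 'b::comm_ring_1"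
  assumes h_1: "h 1 = 1"
    and h_add: "\<And>x y. h (x + y) = h x + h y" and h_mult: "\<And>x y. h (x * y) = h x * h y"
  shows "map_poly h (\<Prod>a\<leftarrow>as. [:- a, 1:]) = (\<Prod>a\<leftarrow>as. [:- h a, 1:])"
proof (induction as)
  case Nil
  have "h 0 = 0" using h_add[of 0 0] by simp
  then show ?case using h_1 by (intro poly_eqI) (simp add: coeff_map_poly)
next
  case (Cons a as)
  have h_0: "h 0 = 0" using h_add[of 0 0] by simp
  have h_minus: "h (- x) = - h x" for x
    using h_add[of x "- x"] h_0 by (simp add: eq_neg_iff_add_eq_0 add.commute)
  have h_diff: "h (x - y) = h x - h y" for x y
    using h_add[of x "- y"] h_minus by simp
  have "map_poly h ([:- a, 1:] * q) = [:- h a, 1:] * map_poly h q" for q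
    by (intro poly_eqI)
      (simp add: coeff_map_poly coeff_pCons h_0 h_minus h_diff h_mult split: nat.split)
  then show ?case using Cons.IH by simp
qed

lemma map_poly_monom_minus_one:
  fixes h :: "'a::comm_ring_1 \<Rightarrow> 'b::comm_ring_1"
  assumes h_1: "h 1 = 1" and h_add: "\<And>x y. h (x + y) = h x + h y"
  shows "map_poly h (monom 1 m - 1) = monom 1 m - 1"
proof -
  have h_0: "h 0 = 0" using h_add[of 0 0] by simp
  have "h (- 1) = - 1"
    using h_add[of 1 "- 1"] h_0 h_1 by (simp add: eq_neg_iff_add_eq_0 add.commute)
  then show ?thesis
    using h_0 h_1 by (intro poly_eqI) (simp add: coeff_map_poly coeff_1)
qed

text \<open>
  The factors found over the field of fractions have their roots in $R$, and polynomials over $R$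
  embed into polynomials over the field.
\<close>

lemma X_pow_minus_one_splits:
  assumes ac: "algebraically_closed TYPE('r::idom fract)" and "0 < m"
    and integral:  "\<And>z :: 'r::idom fract. z ^ m = 1 \<Longrightarrow> z \<in> range to_fract"
  obtains bs :: "'r::idom list" where "monom 1 m - 1 = (\<Prod>b\<leftarrow>bs. [:- b, 1:])"
proof -
  let ?f = "monom 1 m - 1 :: 'r fract poly"
  have "degree ?f = m"
    using \<open>0 < m\<close> degree_add_eq_left[of "- 1" "monom 1 m :: 'r fract poly"]
    by (simp add: degree_monom_eq)
  then have "lead_coeff ?f = 1" using \<open>0 < m\<close> by (simp add: coeff_1)
  then obtain as where as: "?f = (\<Prod>a\<leftarrow>as. [:- a, 1:])" using monic_splits[OF ac] by blast
  have "a ^ m = 1" if "a \<in> set as" for a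
  proof -
    have "poly ?f a = 0"
      using that unfolding as by (induction as) auto
    then show ?thesis by (simp add: poly_monom)
  qed
  then have "\<exists>bs. as = map to_fract bs"
    using integral by (induction as) (auto simp: Cons_eq_map_conv)
  then obtain bs where "as = map to_fract bs" ..
  then have "map_poly to_fract (monom 1 m - 1) = map_poly to_fract (\<Prod>b\<leftarrow>bs. [:- b, 1:] :: 'r poly)"
    using as by (simp only: map_poly_monom_minus_one map_poly_prod_linear to_fract_1 to_fract_add
        to_fract_mult) (simp add: o_def)
  then show ?thesis using that by (simp only: fract_poly_eq_iff)
qed

section \<open>Evaluating the generator at a root of unity\<close>

lemma group_power_add: "group_power u (i + j) = group_power u i + group_power u j"
  by (induction j) (simp_all add: group_power_def add.assoc)

lemma group_power_0 [simp]: "group_power u 0 = 0"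
  and group_power_Suc_0 [simp]: "group_power u (Suc 0) = u"
  by (simp_all add: group_power_def)

lemma group_power_mult_eq_0:
  assumes "group_power u d = 0"
  shows "group_power u (d * q) = 0"
  using assms by (induction q) (simp_all add: group_power_add)

lemma group_power_mod:
  assumes "group_power u d = 0"
  shows "group_power u (l mod d) = group_power u l"
  using group_power_add[of u "d * (l div d)" "l mod d"] group_power_mult_eq_0[OF assms]
  by simp

text \<open>
  The least period $d$ of $u$ exists by finiteness. Reduction modulo $d$ shows that the powers below
  $d$ exhaust the group, negatives included, and minimality shows that they are distinct; so $d$ is
  the order of the group.
\<close>

lemma cyclic_generator_order:
  fixes u :: "'g::{ab_group_add,finite}"
  assumes "cyclic_generator u"
  shows "group_power u CARD('g) = 0" "bij_betw (group_power u) {..<CARD('g)} UNIV"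
proof -
  define d where "d = (LEAST d. 0 < d \<and> group_power u d = 0)"
  have "\<not> inj (group_power u)"
    using finite_imageD[of "group_power u" UNIV] infinite_UNIV_nat by auto
  then obtain i j where ij: "i < j" "group_power u i = group_power u j"
    unfolding inj_on_def by (metis nat_neq_iff)
  then have "group_power u (j - i) = 0" using group_power_add[of u i "j - i"] by simp
  then have d: "0 < d" "group_power u d = 0"
    using ij LeastI[of "\<lambda>d. 0 < d \<and> group_power u d = 0" "j - i"] unfolding d_def by auto
  have minimal: "\<not> (0 < e \<and> group_power u e = 0)" if "e < d" for e
    using not_less_Least that unfolding d_def by blast
  have "i = j" if "i \<le> j" "j < d" "group_power u i = group_power u j" for i j
    using minimal[of "j - i"] that group_power_add[of u i "j - i"] by auto
  then have inj: "inj_on (group_power u) {..<d}"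
    unfolding inj_on_def by (metis lessThan_iff linear)
  have "g \<in> group_power u ` {..<d}" for g
  proof -
    have pow: "group_power u l \<in> group_power u ` {..<d}" for l
      using d group_power_mod[OF d(2), of l] by (intro image_eqI[of _ _ "l mod d"]) auto
    \<comment> \<open>The subtraction does not truncate, as $d \ge 1$.\<close>
    have "- group_power u l = group_power u (d * l - l)" for l
      using group_power_add[of u "d * l - l" l] group_power_mult_eq_0[OF d(2), of l] d(1)
      by (simp add: eq_neg_iff_add_eq_0 neg_eq_iff_add_eq_0 add.commute)
    then show ?thesis
      using assms pow unfolding cyclic_generator_def by metis
  qed
  then have bij: "bij_betw (group_power u) {..<d} UNIV"
    using inj by (auto simp: bij_betw_def)
  then have "CARD('g) = d" using bij_betw_same_card by fastforce
  then show "group_power u CARD('g) = 0" "bij_betw (group_power u) {..<CARD('g)} UNIV"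
    using d bij by simp_all
qed

text \<open>
  The $R$-algebra homomorphism $R[G] \to R$, $u \mapsto \beta$, when $\beta$ is a root of unity of
  order dividing that of the group.
\<close>

definition eval_generator ::
    "'g::{ab_group_add,finite} \<Rightarrow> 'r::comm_ring_1 \<Rightarrow> ('g \<Rightarrow>\<^sub>0 'r) \<Rightarrow> 'r" where
  "eval_generator u \<beta> x = (\<Sum>l<CARD('g). Poly_Mapping.lookup x (group_power u l) * \<beta> ^ l)"

lemma eval_generator_add:
  "eval_generator u \<beta> (x + y) = eval_generator u \<beta> x + eval_generator u \<beta> y"
  by (simp add: eval_generator_def lookup_add distrib_right sum.distrib)

lemma eval_generator_diff:
  "eval_generator u \<beta> (x - y) = eval_generator u \<beta> x - eval_generator u \<beta> y"
  by (simp add: eval_generator_def lookup_minus left_diff_distrib sum_subtractf)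

lemma eval_generator_sum:
  "eval_generator u \<beta> (sum f A) = (\<Sum>a\<in>A. eval_generator u \<beta> (f a))"
proof -
  have "eval_generator u \<beta> 0 = 0" by (simp add: eval_generator_def)
  then show ?thesis
    by (induction A rule: infinite_finite_induct) (simp_all add: eval_generator_add)
qed

context
  fixes u :: "'g::{ab_group_add,finite}"
  assumes u: "cyclic_generator u"
begin

lemma group_ring_expansion:
  "x = (\<Sum>l<CARD('g). Poly_Mapping.single (group_power u l) (Poly_Mapping.lookup x (group_power u l)))"
proof (rule poly_mapping_eqI)
  fix g
  obtain j where j: "j < CARD('g)" "g = group_power u j"
    using cyclic_generator_order(2)[OF u] unfolding bij_betw_def by blast
  have "group_power u l = g \<longleftrightarrow> l = j" if "l < CARD('g)" for l
    using cyclic_generator_order(2)[OF u] that j unfolding bij_betw_def inj_on_def by blast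
  then have "(\<Sum>l<CARD('g). Poly_Mapping.lookup (Poly_Mapping.single (group_power u l)
      (Poly_Mapping.lookup x (group_power u l))) g) =
      (\<Sum>l<CARD('g). if l = j then Poly_Mapping.lookup x (group_power u l) else 0)"
    by (intro sum.cong) (auto simp: lookup_single when_def)
  then show "Poly_Mapping.lookup x g = Poly_Mapping.lookup (\<Sum>l<CARD('g). Poly_Mapping.single
      (group_power u l) (Poly_Mapping.lookup x (group_power u l))) g"
    using j by (simp add: lookup_sum)
qed

lemma single_group_power:
  fixes a :: "'r::comm_ring_1"
  shows "Poly_Mapping.single (group_power u l) a =
     Poly_Mapping.single 0 a * Poly_Mapping.single u 1 ^ l"
proof -
  have "Poly_Mapping.single u (1 :: 'r) ^ l = Poly_Mapping.single (group_power u l) 1"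
    by (induction l)
      (simp_all add: mult_single flip: group_power_add[of u 1, simplified])
  then show ?thesis by (simp add: mult_single)
qed

context
  fixes \<beta> :: "'r::comm_ring_1"
  assumes root: "\<beta> ^ CARD('g) = 1"
begin

lemma eval_generator_single:
  "eval_generator u \<beta> (Poly_Mapping.single (group_power u l) a) = a * \<beta> ^ l"
proof -
  define j where "j = l mod CARD('g)"
  have j: "j < CARD('g)" "group_power u l = group_power u j"
    using group_power_mod[OF cyclic_generator_order(1)[OF u]] by (simp_all add: j_def)
  have "\<beta> ^ l = (\<beta> ^ CARD('g)) ^ (l div CARD('g)) * \<beta> ^ j"
    by (simp add: j_def flip: power_mult power_add)
  then have pow: "\<beta> ^ l = \<beta> ^ j" by (simp add: root)
  have "group_power u j = group_power u i \<longleftrightarrow> i = j" if "i < CARD('g)" for i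
    using cyclic_generator_order(2)[OF u] that j unfolding bij_betw_def inj_on_def by blast
  then have "eval_generator u \<beta> (Poly_Mapping.single (group_power u j) a) =
      (\<Sum>i<CARD('g). if i = j then a * \<beta> ^ i else 0)"
    unfolding eval_generator_def by (intro sum.cong) (auto simp: lookup_single when_def)
  then show ?thesis using j by (simp add: pow)
qed

lemma eval_generator_const: "eval_generator u \<beta> (Poly_Mapping.single 0 a) = a"
  using eval_generator_single[of 0 a] by simp

lemma eval_generator_mult:
  "eval_generator u \<beta> (x * y) = eval_generator u \<beta> x * eval_generator u \<beta> y"
proof -
  let ?a = "\<lambda>l. Poly_Mapping.lookup x (group_power u l)"
  let ?b = "\<lambda>l. Poly_Mapping.lookup y (group_power u l)"
  have "x * y = (\<Sum>i<CARD('g). Poly_Mapping.single (group_power u i) (?a i)) *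
      (\<Sum>j<CARD('g). Poly_Mapping.single (group_power u j) (?b j))"
    using group_ring_expansion[of x] group_ring_expansion[of y] by (rule arg_cong2)
  also have "\<dots> = (\<Sum>i<CARD('g). \<Sum>j<CARD('g).
      Poly_Mapping.single (group_power u (i + j)) (?a i * ?b j))"
    by (simp add: sum_product mult_single group_power_add)
  finally have "eval_generator u \<beta> (x * y) =
      (\<Sum>i<CARD('g). \<Sum>j<CARD('g). ?a i * ?b j * \<beta> ^ (i + j))"
    by (simp add: eval_generator_sum eval_generator_single)
  also have "\<dots> = eval_generator u \<beta> x * eval_generator u \<beta> y"
    unfolding eval_generator_def sum_product
    by (intro sum.cong refl) (simp add: power_add mult_ac)
  finally show ?thesis .
qed

text \<open>
  Because $u^l - \beta^l$ is divisible by $u - \beta$, the kernel of the evaluation is generated by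
  $u - \beta$.
\<close>

lemma generator_minus_root_dvd:
  "Poly_Mapping.single u 1 - Poly_Mapping.single 0 \<beta> dvd
     x - Poly_Mapping.single 0 (eval_generator u \<beta> x)"
proof -
  let ?a = "\<lambda>l. Poly_Mapping.single 0 (Poly_Mapping.lookup x (group_power u l)) :: 'g \<Rightarrow>\<^sub>0 'r"
  let ?u = "Poly_Mapping.single u 1 :: 'g \<Rightarrow>\<^sub>0 'r"
  let ?\<beta> = "Poly_Mapping.single 0 \<beta> :: 'g \<Rightarrow>\<^sub>0 'r"
  have single_sum: "Poly_Mapping.single 0 (sum f A) = (\<Sum>i\<in>A. Poly_Mapping.single 0 (f i) :: 'g \<Rightarrow>\<^sub>0 'r)"
    for f and A :: "nat set"
    by (induction A rule: infinite_finite_induct) (simp_all add: single_add)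
  have single_pow: "Poly_Mapping.single 0 (\<beta> ^ l) = ?\<beta> ^ l" for l
    by (induction l) (simp_all add: mult_single[of 0 _ 0, simplified, symmetric])
  have "Poly_Mapping.single 0 (eval_generator u \<beta> x) = (\<Sum>l<CARD('g). ?a l * ?\<beta> ^ l)"
    unfolding eval_generator_def single_sum
    by (intro sum.cong) (simp_all add: mult_single flip: single_pow)
  moreover have "x = (\<Sum>l<CARD('g). ?a l * ?u ^ l)"
    using group_ring_expansion[of x] by (simp add: single_group_power)
  ultimately have "x - Poly_Mapping.single 0 (eval_generator u \<beta> x) =
      (\<Sum>l<CARD('g). ?a l * (?u ^ l - ?\<beta> ^ l))"
    by (simp add: right_diff_distrib sum_subtractf)
  moreover have "?u - ?\<beta> dvd ?u ^ l - ?\<beta> ^ l" for l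
    by (simp add: power_diff_sumr2)
  ultimately show ?thesis by (simp add: dvd_sum)
qed

end

text \<open>
  The kernel of a multiplicative seminorm is a prime ideal. It contains
  $\prod (u - \beta) = u^M - 1 = 0$, where the product is over the factors of $X^M - 1$, and so it
  contains some $u - \beta$, which generates the kernel of an evaluation.
\<close>

lemma seminorm_vanishes_on_kernel:
  fixes p :: "('g \<Rightarrow>\<^sub>0 'r::idom) \<Rightarrow> real"
  assumes ac: "algebraically_closed TYPE('r::idom fract)"
    and integral: "\<And>z :: 'r fract. z ^ CARD('g) = 1 \<Longrightarrow> z \<in> range to_fract"
    and p: "multiplicative_seminorm p" "p 1 \<noteq> 0"
  obtains \<beta> where "\<beta> ^ CARD('g) = 1"
    "\<And>x. p (x - Poly_Mapping.single 0 (eval_generator u \<beta> x)) = 0"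
proof -
  let ?c = "Poly_Mapping.single 0 :: 'r \<Rightarrow> 'g \<Rightarrow>\<^sub>0 'r"
  let ?u = "Poly_Mapping.single u 1 :: 'g \<Rightarrow>\<^sub>0 'r"
  obtain bs :: "'r list" where bs: "monom 1 CARD('g) - 1 = (\<Prod>b\<leftarrow>bs. [:- b, 1:])"
    using X_pow_minus_one_splits[OF ac zero_less_card_finite integral] by blast
  have "monom 1 CARD('g) - 1 = map_poly ?c (monom 1 CARD('g) - 1)"
    by (rule map_poly_monom_minus_one[symmetric]) (simp_all add: single_add)
  also have "\<dots> = (\<Prod>b\<leftarrow>bs. [:- ?c b, 1:])"
    unfolding bs by (rule map_poly_prod_linear) (simp_all add: single_add mult_single)
  finally have "monom 1 CARD('g) - 1 = (\<Prod>b\<leftarrow>bs. [:- ?c b, 1:])" .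
  then have "poly (monom 1 CARD('g) - 1) ?u = poly (\<Prod>b\<leftarrow>bs. [:- ?c b, 1:]) ?u"
    by (rule arg_cong)
  moreover have "?u ^ CARD('g) = 1"
    using single_group_power[of "CARD('g)" "1 :: 'r"] cyclic_generator_order(1)[OF u] by simp
  ultimately have "poly (\<Prod>b\<leftarrow>bs. [:- ?c b, 1:]) ?u = 0"
    by (simp add: poly_monom)
  moreover have "poly (\<Prod>b\<leftarrow>bs. [:- ?c b, 1:]) ?u = (\<Prod>b\<leftarrow>bs. ?u - ?c b)"
    by (induction bs) (simp_all add: left_diff_distrib)
  ultimately have "p (\<Prod>b\<leftarrow>bs. ?u - ?c b) = 0" using multiplicative_seminormD(2)[OF p(1)] by simp
  moreover have "p (\<Prod>b\<leftarrow>cs. ?u - ?c b) = 0 \<Longrightarrow> \<exists>b\<in>set cs. p (?u - ?c b) = 0" for cs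
    using p(2) by (induction cs) (auto simp: multiplicative_seminormD(5)[OF p(1)])
  ultimately obtain \<beta> where \<beta>: "\<beta> \<in> set bs" "p (?u - ?c \<beta>) = 0" by blast
  have "poly (\<Prod>b\<leftarrow>bs. [:- b, 1:]) \<beta> = 0"
    using \<beta>(1) by (induction bs) auto
  then have root: "\<beta> ^ CARD('g) = 1" by (simp add: poly_monom flip: bs)
  then show ?thesis
    using that multiplicative_seminorm_dvd_zero[OF p(1) generator_minus_root_dvd[OF root] \<beta>(2)]
    by blast
qed

end

section \<open>Quotient spaces\<close>

lemma continuous_map_discrete_prod:
  assumes "\<And>i. i \<in> I \<Longrightarrow> continuous_map Y Z (\<lambda>y. f (i, y))"
  shows "continuous_map (prod_topology (discrete_topology I) Y) Z f"
  unfolding continuous_map_def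
proof (intro conjI allI impI)
  show "f \<in> topspace (prod_topology (discrete_topology I) Y) \<rightarrow> topspace Z"
    using assms by (auto simp: continuous_map_def Pi_iff)
  fix U assume U: "openin Z U"
  have "{x \<in> topspace (prod_topology (discrete_topology I) Y). f x \<in> U} =
      (\<Union>i\<in>I. {i} \<times> {y \<in> topspace Y. f (i, y) \<in> U})"
    by auto
  also have "openin (prod_topology (discrete_topology I) Y) \<dots>"
    using assms U by (intro openin_Union) (auto simp: openin_prod_Times_iff continuous_map_def)
  finally show "openin (prod_topology (discrete_topology I) Y)
      {x \<in> topspace (prod_topology (discrete_topology I) Y). f x \<in> U}" .
qed

lemma topspace_quotient_topology:
  assumes "equiv (topspace X) r"
  shows "topspace (quotient_topology X r) = topspace X // r"
proof -
  have "{x \<in> topspace X. r `` {x} \<in> topspace X // r} = topspace X"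
    by (auto intro: quotientI)
  then have "openin (quotient_topology X r) (topspace X // r)"
    by (simp add: openin_quotient_topology)
  then have "topspace X // r \<subseteq> topspace (quotient_topology X r)" by (rule openin_subset)
  moreover have "topspace (quotient_topology X r) \<subseteq> topspace X // r"
    using openin_topspace[of "quotient_topology X r"] openin_quotient_topology by metis
  ultimately show ?thesis by (rule antisym[rotated])
qed

lemma quotient_map_quotient_topology:
  assumes "equiv (topspace X) r"
  shows "quotient_map X (quotient_topology X r) (\<lambda>x. r `` {x})"
  unfolding quotient_map_def topspace_quotient_topology[OF assms]
  by (auto simp: openin_quotient_topology quotient_def)

text \<open>
  A quotient map factors through the projection to the classes of its own fibres. The induced map
  is again a quotient map, and it is injective, hence a homeomorphism.
\<close>

lemma homeomorphic_map_from_quotient_topology: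
  assumes r: "equiv (topspace X) r" and f: "quotient_map X Y f"
    and fibres: "\<And>x y. \<lbrakk>x \<in> topspace X; y \<in> topspace X\<rbrakk> \<Longrightarrow> f x = f y \<longleftrightarrow> (x, y) \<in> r"
  obtains h where "homeomorphic_map (quotient_topology X r) Y h"
    "\<And>x. x \<in> topspace X \<Longrightarrow> h (r `` {x}) = f x"
proof -
  let ?Q = "quotient_topology X r" and ?\<pi> = "\<lambda>x. r `` {x}"
  have \<pi>: "quotient_map X ?Q ?\<pi>" using quotient_map_quotient_topology[OF r] .
  have classes: "?\<pi> x = ?\<pi> y \<longleftrightarrow> f x = f y" if "x \<in> topspace X" "y \<in> topspace X" for x y
    using that r fibres by (auto simp: eq_equiv_class_iff)
  obtain h where h: "continuous_map ?Q Y h" "\<And>x. x \<in> topspace X \<Longrightarrow> h (?\<pi> x) = f x"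
    using quotient_map_lift_exists[OF \<pi> quotient_imp_continuous_map[OF f]] classes by metis
  have "quotient_map X Y (h \<circ> ?\<pi>)"
    using quotient_map_eq[OF f] h(2) by simp
  then have "quotient_map ?Q Y h"
    using quotient_map_from_composition[OF quotient_imp_continuous_map[OF \<pi>] h(1)] by simp
  moreover have "inj_on h (topspace ?Q)"
    unfolding topspace_quotient_topology[OF r] inj_on_def quotient_def
    using h(2) classes by auto
  ultimately have "homeomorphic_map ?Q Y h" by (simp add: homeomorphic_map_def)
  then show ?thesis using that h(2) by blast
qed

lemma compact_space_intervals_topology: "compact_space (intervals_topology n)"
  unfolding intervals_topology_def
  by (simp add: compact_space_prod_topology compact_space_discrete_topology
      compact_space_subtopology compact_eq_closed)

lemma topspace_intervals_topology: "topspace (intervals_topology n) = {1..n} \<times> {1..\<infinity>}"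
  by (simp add: intervals_topology_def)

lemma Hausdorff_space_berkovich_topology: "Hausdorff_space (berkovich_topology N)"
  unfolding berkovich_topology_def
  by (intro Hausdorff_space_subtopology) (simp add: Hausdorff_space_product_topology)


section \<open>The seminorms on the group ring\<close>

lemma to_fract_power: "to_fract (x ^ l) = to_fract x ^ l"
  by (induction l) simp_all

lemma alpha_seminorm_to_fract:
  "alpha_seminorm v u (to_fract \<beta>) \<omega> x = ext_powr (v (to_fract (eval_generator u \<beta> x))) (ereal \<omega>)"
  by (simp add: alpha_seminorm_def eval_generator_def to_fract_power)

lemma residue_to_fract: "residue Q (to_fract r) = Q r"
  by (simp add: residue_def inv_f_f inj_def)

lemma residue_field_mapD:
  assumes "residue_field_map Q"
  shows "Q 1 = 1" "Q (x + y) = Q x + Q y" "Q (x * y) = Q x * Q y" "Q x = 0 \<longleftrightarrow> \<not> x dvd 1"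
  using assms unfolding residue_field_map_def by simp_all

lemma residue_field_map_diff:
  assumes "residue_field_map Q"
  shows "Q (x - y) = Q x - Q y"
  using residue_field_mapD(2)[OF assms, of "x - y" y] by simp

lemma residue_field_map_sum:
  assumes "residue_field_map Q"
  shows "Q (sum f A) = (\<Sum>a\<in>A. Q (f a))"
proof -
  have "Q 0 = 0" using residue_field_mapD(4)[OF assms, of 0] by simp
  then show ?thesis
    by (induction A rule: infinite_finite_induct) (simp_all add: residue_field_mapD(2)[OF assms])
qed

lemma residue_field_map_power:
  assumes "residue_field_map Q"
  shows "Q (x ^ l) = Q x ^ l"
  by (induction l) (simp_all add: residue_field_mapD[OF assms])

lemma residue_eval_generator:
  assumes "residue_field_map Q"
  shows "Q (eval_generator u \<beta> x) =
    (\<Sum>l<CARD('g::{ab_group_add,finite}). Q (Poly_Mapping.lookup x (group_power (u :: 'g) l)) * Q \<beta> ^ l)"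
  by (simp add: eval_generator_def residue_field_map_sum[OF assms]
      residue_field_map_power[OF assms] residue_field_mapD(3)[OF assms])

lemma beta_seminorm_to_fract:
  assumes "residue_field_map Q"
  shows "beta_seminorm Q u (to_fract \<beta>) x = trivial_norm (Q (eval_generator u \<beta> x))"
  by (simp add: beta_seminorm_def eval_generator_def residue_field_map_sum[OF assms]
      residue_to_fract flip: to_fract_mult to_fract_power)

lemma (in rank_one_valuation) trivial_norm_residue:
  assumes "residue_field_map Q"
  shows "trivial_norm (Q r) = ext_powr (w r) \<infinity>"
  using residue_field_mapD(4)[OF assms, of r] by (simp add: trivial_norm_def eq_1_iff)

lemma root_of_unity_integral:
  fixes v :: "'r::idom fract \<Rightarrow> real" and z :: "'r fract"
  assumes iav: "induced_absolute_value v" and "0 < m" "z ^ m = 1"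
  shows "z \<in> range to_fract"
proof -
  have mult: "\<And>x y. v (x * y) = v x * v y" and ball: "\<And>x. v x \<le> 1 \<longleftrightarrow> x \<in> range to_fract"
    using iav unfolding induced_absolute_value_def by blast+
  have "v 1 \<le> 1" using ball[of 1] rangeI[of to_fract 1] by simp
  have pow: "v (z ^ k) = v z ^ k" if "0 < k" for k
    using that by (induction k rule: nat_induct_non_zero) (simp_all add: mult)
  have "v z \<le> 1"
  proof (rule ccontr)
    assume "\<not> v z \<le> 1"
    then have "1 < v z ^ m" using \<open>0 < m\<close> by (intro one_less_power) auto
    then show False using pow[OF \<open>0 < m\<close>] \<open>z ^ m = 1\<close> \<open>v 1 \<le> 1\<close> by simp
  qed
  then show ?thesis using ball by blast
qed

section \<open>The spectrum as a space of glued intervals\<close>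

text \<open>
  The roots are given as elements of $R$ here, so that evaluation at them stays in $R$.
\<close>

definition spectrum_param ::
    "('r::idom fract \<Rightarrow> real) \<Rightarrow> 'g::{ab_group_add,finite} \<Rightarrow> (nat \<Rightarrow> 'r) \<Rightarrow> nat \<times> ereal \<Rightarrow> ('g \<Rightarrow>\<^sub>0 'r) \<Rightarrow> real"
  where
  "spectrum_param v u \<beta> = (\<lambda>(k, s) x. ext_powr (v (to_fract (eval_generator u (\<beta> k) x))) s)"

context
  fixes v :: "'r::idom fract \<Rightarrow> real"
    and u :: "'g::{ab_group_add,finite}"
    and n :: nat
    and \<beta> :: "nat \<Rightarrow> 'r"
  assumes iav: "induced_absolute_value v"
    and u: "cyclic_generator u"
    and \<beta>_bij: "bij_betw \<beta> {1..n} {z. z ^ CARD('g) = 1}"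
begin

interpretation rank_one_valuation "\<lambda>r. v (to_fract r)"
  using iav by (rule rank_one_valuation_of_absolute_value)

lemma \<beta>_root: "k \<in> {1..n} \<Longrightarrow> \<beta> k ^ CARD('g) = 1"
  using \<beta>_bij by (auto simp: bij_betw_def)

text \<open>
  The ultrametric inequality bounds the sum by its largest term, and elements of $R$ have absolute
  value at most one, so powers of $z$ do not increase a coefficient.
\<close>

lemma eval_generator_le_norm:
  "v (to_fract (eval_generator u z x)) \<le> group_ring_norm v x"
proof -
  have coeff: "v (to_fract (Poly_Mapping.lookup x g)) \<le> group_ring_norm v x" for g
    unfolding group_ring_norm_def by (intro Max_ge) auto
  have "v (to_fract (a * z ^ l)) \<le> v (to_fract a)" for a l
    by (simp add: le_iff_dvd del: to_fract_mult)
  then have "v (to_fract (Poly_Mapping.lookup x (group_power u l) * z ^ l)) \<le> group_ring_norm v x" for l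
    using coeff order_trans by blast
  then show ?thesis
    unfolding eval_generator_def
    using order_trans[OF nonneg coeff] by (intro sum_le) auto
qed

lemma group_ring_norm_const: "group_ring_norm v (Poly_Mapping.single 0 r :: 'g \<Rightarrow>\<^sub>0 'r) \<le> v (to_fract r)"
  unfolding group_ring_norm_def using nonneg[of r] zero
  by (intro Max.boundedI) (auto simp: lookup_single when_def)

lemma spectrum_group_ring:
  assumes ac: "algebraically_closed TYPE('r fract)" and \<pi>: "\<pi> \<noteq> (0 :: 'r)" "\<not> \<pi> dvd 1"
  shows "berkovich_spectrum (group_ring_norm v :: ('g \<Rightarrow>\<^sub>0 'r) \<Rightarrow> real) =
    spectrum_param v u \<beta> ` topspace (intervals_topology n)"
proof -
  have w\<pi>: "0 < v (to_fract \<pi>)" "v (to_fract \<pi>) < 1"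
    using \<pi> nonneg[of \<pi>] eq_0_iff[of \<pi>] le_1[of \<pi>] eq_1_iff[of \<pi>] by linarith+
  have kernel: "\<exists>k\<in>{1..n}. \<forall>x. p (x - Poly_Mapping.single 0 (eval_generator u (\<beta> k) x)) = 0"
    if "p \<in> berkovich_spectrum (group_ring_norm v)" for p :: "('g \<Rightarrow>\<^sub>0 'r) \<Rightarrow> real"
  proof -
    have p: "multiplicative_seminorm p" "p 1 \<noteq> 0"
      using that multiplicative_seminorm_one[of p] by (auto simp: berkovich_spectrum_def)
    obtain z where "z ^ CARD('g) = 1" "\<And>x. p (x - Poly_Mapping.single 0 (eval_generator u z x)) = 0"
      using seminorm_vanishes_on_kernel[OF u ac root_of_unity_integral[OF iav zero_less_card_finite] p]
      by metis
    moreover from this have "z \<in> \<beta> ` {1..n}" using \<beta>_bij by (simp add: bij_betw_def)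
    ultimately show ?thesis by blast
  qed
  have "berkovich_spectrum (group_ring_norm v :: ('g \<Rightarrow>\<^sub>0 'r) \<Rightarrow> real) =
      {\<lambda>x. q (eval_generator u (\<beta> k) x) | k q.
         k \<in> {1..n} \<and> q \<in> berkovich_spectrum (\<lambda>r. v (to_fract r))}"
    by (rule berkovich_spectrum_pullback[where c = "Poly_Mapping.single 0", OF _ _ _ _ _ _ _ kernel])
      (simp_all add: single_add mult_single eval_generator_add eval_generator_mult[OF u \<beta>_root]
        eval_generator_const[OF u \<beta>_root] group_ring_norm_const eval_generator_le_norm
        del: atLeastAtMost_iff)
  also have "\<dots> = spectrum_param v u \<beta> ` ({1..n} \<times> {1..\<infinity>})"
  proof (intro equalityI subsetI)
    fix p assume "p \<in> {\<lambda>x. q (eval_generator u (\<beta> k) x) | k q.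
         k \<in> {1..n} \<and> q \<in> berkovich_spectrum (\<lambda>r. v (to_fract r))}"
    then obtain k q where kq: "k \<in> {1..n}" "q \<in> berkovich_spectrum (\<lambda>r. v (to_fract r))"
      and p: "p = (\<lambda>x. q (eval_generator u (\<beta> k) x))" by blast
    obtain s where "1 \<le> s" "q = (\<lambda>r. ext_powr (v (to_fract r)) s)"
      using spectrum_imp_ext_powr[OF w\<pi> kq(2)] .
    then show "p \<in> spectrum_param v u \<beta> ` ({1..n} \<times> {1..\<infinity>})"
      using kq(1) p by (intro image_eqI[of _ _ "(k, s)"]) (simp_all add: spectrum_param_def)
  next
    fix p assume "p \<in> spectrum_param v u \<beta> ` ({1..n} \<times> {1..\<infinity>})"
    then obtain k s where "k \<in> {1..n}" "1 \<le> s" "p = spectrum_param v u \<beta> (k, s)" by auto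
    then show "p \<in> {\<lambda>x. q (eval_generator u (\<beta> k) x) | k q.
         k \<in> {1..n} \<and> q \<in> berkovich_spectrum (\<lambda>r. v (to_fract r))}"
      using ext_powr_in_spectrum[of s] unfolding spectrum_param_def by fast
  qed
  finally show ?thesis by (simp add: topspace_intervals_topology)
qed

lemma continuous_map_spectrum_param:
  "continuous_map (intervals_topology n) (powertop_real UNIV) (spectrum_param v u \<beta>)"
  unfolding continuous_map_componentwise_UNIV intervals_topology_def
proof (intro allI continuous_map_discrete_prod)
  fix x k
  have "continuous_on {1..\<infinity>} (ext_powr (v (to_fract (eval_generator u (\<beta> k) x))))"
    by (intro continuous_on_ext_powr) simp
  then show "continuous_map (subtopology euclidean {1..\<infinity>}) euclideanreal
      (\<lambda>s. spectrum_param v u \<beta> (k, s) x)"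
    by (simp add: spectrum_param_def)
qed

text \<open>
  A non-unit constant separates exponents, and $u - \beta_k$ separates the evaluations at $\beta_k$
  and at $\beta_l$ unless $\beta_l - \beta_k$ is killed by the seminorm on $R$. For an infinite
  exponent only the residue of the evaluation matters, which depends on the residue of the root.
\<close>

lemma spectrum_param_eq_iff:
  fixes Q :: "'r \<Rightarrow> 'f::field"
  assumes Q: "residue_field_map Q" and \<pi>: "\<pi> \<noteq> (0 :: 'r)" "\<not> \<pi> dvd 1"
    and dom: "i \<in> topspace (intervals_topology n)" "j \<in> topspace (intervals_topology n)"
  shows "spectrum_param v u \<beta> i = spectrum_param v u \<beta> j \<longleftrightarrow>
    (i, j) \<in> gluing Q n (\<lambda>k. to_fract (\<beta> k))"
proof -
  obtain k s l t where ij: "i = (k, s)" "j = (l, t)" by fastforce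
  then have k: "k \<in> {1..n}" and l: "l \<in> {1..n}" and s: "1 \<le> s" and t: "1 \<le> t"
    using dom by (auto simp: topspace_intervals_topology)
  have "k = l \<and> s = t \<or> s = \<infinity> \<and> t = \<infinity> \<and> Q (\<beta> k) = Q (\<beta> l)"
    if "spectrum_param v u \<beta> i = spectrum_param v u \<beta> j"
  proof -
    have eq: "ext_powr (v (to_fract (eval_generator u (\<beta> k) x))) s =
        ext_powr (v (to_fract (eval_generator u (\<beta> l) x))) t" for x
      using fun_cong[OF that, of x] by (simp add: spectrum_param_def ij)
    have "0 < v (to_fract \<pi>)" "v (to_fract \<pi>) < 1"
      using \<pi> nonneg[of \<pi>] eq_0_iff[of \<pi>] le_1[of \<pi>] eq_1_iff[of \<pi>] by linarith+
    moreover have "ext_powr (v (to_fract \<pi>)) s = ext_powr (v (to_fract \<pi>)) t"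
      using eq[of "Poly_Mapping.single 0 \<pi>"]
      by (simp only: eval_generator_const[OF u \<beta>_root[OF k]] eval_generator_const[OF u \<beta>_root[OF l]])
    ultimately have "s = t" using s t by (intro ext_powr_inj)
    \<comment> \<open>The evaluation at $\beta_k$ annihilates $u - \beta_k$.\<close>
    define x where "x = Poly_Mapping.single u 1 - Poly_Mapping.single 0 (\<beta> k)"
    have eval_x: "eval_generator u (\<beta> m) x = \<beta> m - \<beta> k" if "m \<in> {1..n}" for m
      using eval_generator_single[OF u \<beta>_root[OF that], of 1 1]
      by (simp add: x_def eval_generator_diff eval_generator_const[OF u \<beta>_root[OF that]])
    have "ext_powr (v (to_fract (\<beta> l - \<beta> k))) t = 0"
      using eq[of x] zero by (simp add: eval_x[OF k] eval_x[OF l] del: to_fract_diff)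
    then have "\<beta> l = \<beta> k \<or> t = \<infinity> \<and> \<not> (\<beta> l - \<beta> k) dvd 1"
      using ext_powr_eq_0_iff[of "v (to_fract (\<beta> l - \<beta> k))" t] nonneg[of "\<beta> l - \<beta> k"]
        le_1[of "\<beta> l - \<beta> k"] eq_0_iff[of "\<beta> l - \<beta> k"] eq_1_iff[of "\<beta> l - \<beta> k"]
      by (auto simp del: to_fract_diff)
    then show ?thesis
    proof
      assume "\<beta> l = \<beta> k"
      then have "k = l" using inj_onD[OF bij_betw_imp_inj_on[OF \<beta>_bij] _ l k] by simp
      then show ?thesis using \<open>s = t\<close> by simp
    next
      assume "t = \<infinity> \<and> \<not> (\<beta> l - \<beta> k) dvd 1"
      then show ?thesis
        using \<open>s = t\<close> residue_field_mapD(4)[OF Q, of "\<beta> l - \<beta> k"]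
        by (simp add: residue_field_map_diff[OF Q])
    qed
  qed
  moreover have "spectrum_param v u \<beta> (k, \<infinity>) = spectrum_param v u \<beta> (l, \<infinity>)"
    if "Q (\<beta> k) = Q (\<beta> l)"
    by (simp only: spectrum_param_def prod.case trivial_norm_residue[OF Q, symmetric]
        residue_eval_generator[OF Q] that)
  ultimately show ?thesis
    using k l s t by (auto simp: gluing_def ij residue_to_fract)
qed

end

theorem corollary2p13:
  fixes v :: "'r::idom fract \<Rightarrow> real"
    and Q :: "'r \<Rightarrow> 'f::field"
    and u :: "'g::{ab_group_add,finite}"
    and M n :: nat
    and b :: "nat \<Rightarrow> 'r fract"
  assumes "complete_valuation_ring v"
    and "\<not> (\<forall>x :: 'r. x \<noteq> 0 \<longrightarrow> x dvd 1)"
    and "residue_field_map Q"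
    and "algebraically_closed TYPE('r fract)"
    and "CARD('g) = M"
    and "cyclic_generator u"
    and "bij_betw b {1..n} {z. z ^ M = 1}"
  shows "berkovich_spectrum (group_ring_norm v :: ('g \<Rightarrow>\<^sub>0 'r) \<Rightarrow> real) =
           {alpha_seminorm v u (b k) \<omega> | k \<omega>. k \<in> {1..n} \<and> 1 \<le> \<omega>} \<union>
           {beta_seminorm Q u (b k) | k. k \<in> {1..n}}
         \<and> (\<exists>h. homeomorphic_map
               (quotient_topology (intervals_topology n) (gluing Q n b))
               (berkovich_topology (group_ring_norm v :: ('g \<Rightarrow>\<^sub>0 'r) \<Rightarrow> real)) h \<and>
             (\<forall>k\<in>{1..n}.
               (\<forall>\<omega>\<ge>1. h (gluing Q n b `` {(k, ereal \<omega>)}) = alpha_seminorm v u (b k) \<omega>) \<and>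
               h (gluing Q n b `` {(k, \<infinity>)}) = beta_seminorm Q u (b k)))"
proof -
  have iav: "induced_absolute_value v"
    using assms(1) by (simp add: complete_valuation_ring_def)
  interpret rank_one_valuation "\<lambda>r. v (to_fract r)"
    using iav by (rule rank_one_valuation_of_absolute_value)
  obtain \<pi> :: 'r where \<pi>: "\<pi> \<noteq> 0" "\<not> \<pi> dvd 1" using assms(2) by blast
  define \<beta> where "\<beta> k = inv to_fract (b k)" for k
  have b: "b k = to_fract (\<beta> k)" if "k \<in> {1..n}" for k
  proof -
    have "b k ^ M = 1" using that assms(7) by (auto simp: bij_betw_def)
    moreover have "0 < M" using assms(5) by auto
    ultimately have "b k \<in> range to_fract" using root_of_unity_integral[OF iav] by blast
    then show ?thesis by (simp add: \<beta>_def f_inv_into_f)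
  qed
  have \<beta>_bij: "bij_betw \<beta> {1..n} {z. z ^ CARD('g) = 1}"
    unfolding bij_betw_def
  proof (intro conjI equalityI subsetI)
    show "inj_on \<beta> {1..n}"
      using assms(7) b unfolding bij_betw_def inj_on_def by metis
    have root_iff: "z ^ CARD('g) = 1 \<longleftrightarrow> to_fract z ^ M = 1" for z :: 'r
      using to_fract_eq_iff[of "z ^ M" 1] assms(5) by (simp add: to_fract_power del: to_fract_eq_iff)
    show "z \<in> {z. z ^ CARD('g) = 1}" if "z \<in> \<beta> ` {1..n}" for z
      using that b assms(7) unfolding root_iff bij_betw_def by force
    show "z \<in> \<beta> ` {1..n}" if "z \<in> {z. z ^ CARD('g) = 1}" for z
    proof -
      have "to_fract z \<in> b ` {1..n}"
        using that assms(7) unfolding root_iff bij_betw_def by simp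
      then show ?thesis using b by (auto simp del: atLeastAtMost_iff)
    qed
  qed
  let ?X = "intervals_topology n" and ?N = "group_ring_norm v :: ('g \<Rightarrow>\<^sub>0 'r) \<Rightarrow> real"
  let ?\<Phi> = "spectrum_param v u \<beta>"
  have alpha: "alpha_seminorm v u (b k) \<omega> = ?\<Phi> (k, ereal \<omega>)" if "k \<in> {1..n}" for k \<omega>
    by (simp add: b[OF that] spectrum_param_def alpha_seminorm_to_fract fun_eq_iff)
  have beta: "beta_seminorm Q u (b k) = ?\<Phi> (k, \<infinity>)" if "k \<in> {1..n}" for k
    by (simp only: b[OF that] spectrum_param_def beta_seminorm_to_fract[OF assms(3)] fun_eq_iff
        trivial_norm_residue[OF assms(3)] prod.case simp_thms)
  have spectrum: "berkovich_spectrum ?N = ?\<Phi> ` topspace ?X"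
    using spectrum_group_ring[OF iav assms(6) \<beta>_bij assms(4) \<pi>] .
  have part_a: "berkovich_spectrum ?N =
      {alpha_seminorm v u (b k) \<omega> | k \<omega>. k \<in> {1..n} \<and> 1 \<le> \<omega>} \<union>
      {beta_seminorm Q u (b k) | k. k \<in> {1..n}}" (is "_ = ?R")
  proof (intro equalityI subsetI)
    fix p assume "p \<in> berkovich_spectrum ?N"
    then obtain k s where k: "k \<in> {1..n}" and s: "1 \<le> s" and p: "p = ?\<Phi> (k, s)"
      unfolding spectrum topspace_intervals_topology by auto
    show "p \<in> ?R"
    proof (cases s)
      case (real \<omega>)
      then have "p = alpha_seminorm v u (b k) \<omega>" "1 \<le> \<omega>"
        using s by (simp_all only: p alpha[OF k] ereal_less_eq one_ereal_def)
      then show ?thesis using k by blast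
    next
      case PInf
      then have "p = beta_seminorm Q u (b k)" by (simp only: p beta[OF k])
      then show ?thesis using k by blast
    qed (use s in simp)
  next
    fix p assume "p \<in> ?R"
    then consider (alpha) k \<omega> where "k \<in> {1..n}" "1 \<le> \<omega>" "p = alpha_seminorm v u (b k) \<omega>"
      | (beta) k where "k \<in> {1..n}" "p = beta_seminorm Q u (b k)"
      by blast
    then show "p \<in> berkovich_spectrum ?N"
    proof cases
      case alpha': alpha
      then show ?thesis
        by (simp add: alpha spectrum topspace_intervals_topology)
    next
      case beta': beta
      then show ?thesis
        by (simp add: beta spectrum topspace_intervals_topology)
    qed
  qed
  have gluing: "gluing Q n b = gluing Q n (\<lambda>k. to_fract (\<beta> k))"
    unfolding gluing_def using b by auto
  have topspace: "topspace (berkovich_topology ?N) = berkovich_spectrum ?N"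
    by (simp add: berkovich_topology_def)
  \<comment> \<open>A continuous surjection from a compact space to a Hausdorff space is a quotient map.\<close>
  have "continuous_map ?X (berkovich_topology ?N) ?\<Phi>"
    unfolding berkovich_topology_def spectrum
    using continuous_map_spectrum_param[OF iav assms(6) \<beta>_bij]
    by (auto simp: continuous_map_in_subtopology)
  then have "quotient_map ?X (berkovich_topology ?N) ?\<Phi>"
    using compact_space_intervals_topology Hausdorff_space_berkovich_topology
    by (rule continuous_imp_quotient_map) (simp only: topspace spectrum)
  then obtain h where h: "homeomorphic_map (quotient_topology ?X (gluing Q n b)) (berkovich_topology ?N) h"
    "\<And>i. i \<in> topspace ?X \<Longrightarrow> h (gluing Q n b `` {i}) = ?\<Phi> i"
    using homeomorphic_map_from_quotient_topology[OF equiv_gluing]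
      spectrum_param_eq_iff[OF iav assms(6) \<beta>_bij assms(3) \<pi>]
    unfolding gluing by metis
  have "\<forall>k\<in>{1..n}. (\<forall>\<omega>\<ge>1. h (gluing Q n b `` {(k, ereal \<omega>)}) = alpha_seminorm v u (b k) \<omega>) \<and>
      h (gluing Q n b `` {(k, \<infinity>)}) = beta_seminorm Q u (b k)"
    using h(2) alpha beta by (simp add: topspace_intervals_topology)
  then show ?thesis using part_a h(1) by blast
qed

end
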